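(* Let $q=1+16a^2$ be a prime power with $a$ a positive integer, $\gamma$ a primitive element of $\mathbb{F}_q$, $l=\frac{q-1}{4}$, and let $G$ be the group on $\mathbb{F}_q\times\mathbb{Z}_l$ with multiplication $(x,i)(y,j)=(x+\gamma^{4i}y,\ i+j)$. Let $S=\{-1+x: x\in D_2^4\}$ and $E=\{(x,i): x\in S,\ i\in\mathbb{Z}_l\}$. Then $\mathrm{Cay}(G,E)$ is a directed strongly regular graph with parameters $\left(\frac{q(q-1)}{4},\ \left(\frac{q-1}{4}\right)^2,\ \left(\frac{q-1}{8}\right)^2,\ \left(\frac{q-1}{8}\right)^2-\frac{q-1}{16},\ \left(\frac{q-1}{8}\right)^2\right)$.
   Context: The cyclotomic classes of order $e$ (for $e\mid q-1$) with respect to the primitive element $\gamma$ are $D_i^e=\gamma^i\langle\gamma^e\rangle$, $i=0,\dots,e-1$. The Cayley digraph $\mathrm{Cay}(G,E)$ has vertex set $G$ and an arc $g\to h$ iff $g^{-1}h\in E$. A directed strongly regular graph with parameters $(v,k,t,\lambda,\mu)$ is a digraph (no loops, no multiple arcs) on $v$ vertices whose adjacency matrix $A$ satisfies $A^2=tI+\lambda A+\mu(J-I-A)$ and $AJ=JA=kJ$. (The paper's printed set "$-1+D_2^2\cup\{0\}$" is a misprint; the class $D_2^4$ is what its proof and parameters use.) *)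

theory Defs
  imports "HOL-Algebra.Group" "HOL-Library.Cardinality"
begin

definition primitive_element :: "'a::{field,finite} \<Rightarrow> bool" where
  "primitive_element \<gamma> \<longleftrightarrow> \<gamma> \<noteq> 0 \<and> (\<forall>x. x \<noteq> 0 \<longrightarrow> (\<exists>k::nat. x = \<gamma> ^ k))"

definition cyclotomic_class :: "'a::{field,finite} \<Rightarrow> nat \<Rightarrow> nat \<Rightarrow> 'a set" where
  "cyclotomic_class \<gamma> e i = {\<gamma> ^ i * (\<gamma> ^ e) ^ k | k. True}"

definition semidirect_grp :: "'a::{field,finite} \<Rightarrow> nat \<Rightarrow> ('a \<times> nat) monoid" where
  "semidirect_grp \<gamma> l = \<lparr> carrier = UNIV \<times> {0..<l},
      mult = (\<lambda>(x,i) (y,j). (x + \<gamma> ^ (4 * i) * y, (i + j) mod l)),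
      one = (0, 0) \<rparr>"

definition cayley_arc :: "('g, 'b) monoid_scheme \<Rightarrow> 'g set \<Rightarrow> 'g \<Rightarrow> 'g \<Rightarrow> bool" where
  "cayley_arc G E g h \<longleftrightarrow> inv\<^bsub>G\<^esub> g \<otimes>\<^bsub>G\<^esub> h \<in> E"

text \<open>Directed strongly regular graph with parameters (v,k,t,lambda,mu) on vertex set V with
  arc relation A, stated entrywise: no loops; A J = J A = k J (all out- and in-degrees k);
  (A^2)_{xy} = t if x = y, lambda if x -> y, mu otherwise.\<close>
definition dsrg :: "'v set \<Rightarrow> ('v \<Rightarrow> 'v \<Rightarrow> bool) \<Rightarrow> nat \<Rightarrow> nat \<Rightarrow> nat \<Rightarrow> nat \<Rightarrow> nat \<Rightarrow> bool" where
  "dsrg V A v k t lam mu \<longleftrightarrow>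
     finite V \<and> card V = v \<and>
     (\<forall>x\<in>V. \<not> A x x) \<and>
     (\<forall>x\<in>V. card {y\<in>V. A x y} = k) \<and>
     (\<forall>y\<in>V. card {x\<in>V. A x y} = k) \<and>
     (\<forall>x\<in>V. \<forall>y\<in>V. card {z\<in>V. A x z \<and> A z y} =
         (if x = y then t else if A x y then lam else mu))"

end

theory Submission
  imports Defs Complex_Main "HOL-Number_Theory.Number_Theory" "HOL-Algebra.Sylow"
begin

text \<open>
  There is an arc from \<open>(x, i)\<close> to \<open>(y, j)\<close> iff \<open>(y - x) / \<gamma>\<^sup>4\<^sup>i \<in> S\<close>, so the theorem reduces to the claim
  that every quartic class \<open>D\<^sub>j\<close> contains exactly \<open>a\<^sup>2\<close> elements of \<open>S\<close>, i.e. that the cyclotomic numbers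
  \<open>(j, 2)\<close> of order 4 are all equal. Their symmetries leave two values with sum \<open>2a\<^sup>2\<close>, and the
  difference of these is read off the real part \<open>R\<close> of the Jacobi sum \<open>J = \<Sum>x. \<chi>(x) \<chi>\<^sup>2(x + 1)\<close> of
  a quartic character: they agree iff \<open>R = -1\<close>. The norm of \<open>J\<close> is \<open>q = 1 + (4a)\<^sup>2\<close>, and \<open>J\<close> is
  not divisible by the characteristic \<open>p\<close>, since modulo a prime above \<open>p\<close> it is \<open>- binom(2l, l)\<close>,
  which is prime to \<open>p\<close>. As \<open>q\<close> has only one primitive representation as a sum of two
  squares, \<open>R\<^sup>2 = 1\<close>, and \<open>R \<equiv> -1\<close> modulo 4 fixes the sign.
\<close>

section \<open>Prime powers, binomial coefficients and sums of two squares\<close>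

text \<open>By Sylow, a prime \<open>r\<close> dividing the order yields an additive subgroup of
  order \<open>r\<close>. Its nonzero elements are killed by \<open>r\<close>, which forces
  \<open>r\<close> to be the characteristic.\<close>

lemma CARD_field_prime_power:
  obtains m where "CARD('a::{field,finite}) = CHAR('a) ^ m"
proof -
  define G :: "'a monoid" where "G = \<lparr>carrier = UNIV, monoid.mult = (+), one = 0\<rparr>"
  interpret G: group G
  proof (rule groupI)
    fix x assume "x \<in> carrier G"
    show "\<exists>y\<in>carrier G. y \<otimes>\<^bsub>G\<^esub> x = \<one>\<^bsub>G\<^esub>"
      by (rule bexI[of _ "- x"]) (simp_all add: G_def)
  qed (simp_all add: G_def add.assoc)
  have pow: "x [^]\<^bsub>G\<^esub> n = of_nat n * x" for x :: 'a and n :: nat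
  proof (induction n)
    case 0
    show ?case using G.nat_pow_0[of x] by (simp add: G_def)
  next
    case (Suc n)
    thus ?case using G.nat_pow_Suc[of x n] by (simp add: G_def algebra_simps)
  qed
  have pr: "prime CHAR('a)"
    by (intro prime_CHAR_semidom finite_imp_CHAR_pos) simp
  have *: "r = CHAR('a)" if r: "prime r" "r dvd CARD('a)" for r
  proof -
    obtain k where k: "CARD('a) = r ^ 1 * k" using r(2) by auto
    obtain H where H: "subgroup H G" "card H = r ^ 1"
      using sylow_thm[OF r(1) G.group_axioms, of 1 k] k by (auto simp: G_def order_def)
    have "H \<noteq> {0}" using H(2) r(1) prime_gt_1_nat by force
    moreover have "0 \<in> H" using subgroup.one_closed[OF H(1)] by (simp add: G_def)
    ultimately obtain x where x: "x \<in> H" "x \<noteq> 0" by blast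
    interpret H: group "G\<lparr>carrier := H\<rparr>"
      using subgroup.subgroup_is_group[OF H(1) G.group_axioms] .
    have "x [^]\<^bsub>G\<lparr>carrier := H\<rparr>\<^esub> r = \<one>\<^bsub>G\<lparr>carrier := H\<rparr>\<^esub>"
      using H.pow_order_eq_1[of x] x H(2) by (simp add: order_def)
    hence "of_nat r * x = 0"
      using pow[of x r] by (simp add: nat_pow_def G_def)
    hence "CHAR('a) dvd r" using x by (simp add: of_nat_eq_0_iff_char_dvd)
    thus ?thesis using primes_dvd_imp_eq[OF pr r(1)] by simp
  qed
  have "CARD('a) = (\<Prod>r\<in>prime_factors CARD('a). r ^ multiplicity r CARD('a))"
    by (rule prime_factorization_nat) simp
  also have "\<dots> = (\<Prod>r\<in>{CHAR('a)}. r ^ multiplicity r CARD('a))"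
    using pr * by (intro prod.mono_neutral_left)
       (auto simp: in_prime_factors_iff not_dvd_imp_multiplicity_0)
  finally show ?thesis using that by simp
qed

text \<open>One step of Legendre's formula: among the factors of the factorial only the
  \<open>n\<close> multiples of \<open>p\<close> count, and dividing each of them by
  \<open>p\<close> leaves \<open>fact n\<close>.\<close>

lemma multiplicity_fact_mult_add:
  fixes p :: nat
  assumes p: "prime p" and "r < p"
  shows "multiplicity p (fact (p * n + r)) = n + multiplicity p (fact n :: nat)"
  using assms(2)
proof (induction n arbitrary: r)
  case 0
  have "\<not> p dvd fact r" using 0 p by (simp add: prime_dvd_fact_iff)
  thus ?case by (simp add: not_dvd_imp_multiplicity_0)
next
  case (Suc n)
  have pe: "prime_elem p" using p by simp
  show ?case using Suc.prems
  proof (induction r)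
    case 0
    have p0: "p > 0" using p prime_gt_0_nat by blast
    \<comment> \<open>The block of factors before \<open>p * Suc n\<close> ends at residue
      \<open>p - 1\<close>. The outer hypothesis is used there, so \<open>r\<close> must stay
      arbitrary in it.\<close>
    have "(fact (p * Suc n) :: nat) = p * Suc n * fact (p * n + (p - 1))"
      using fact_reduce[of "p * Suc n", where 'a = nat] p0 by (simp add: algebra_simps)
    hence "multiplicity p (fact (p * Suc n) :: nat)
         = multiplicity p (p * Suc n) + (n + multiplicity p (fact n :: nat))"
      using Suc.IH[of "p - 1"] p0 by (simp add: prime_elem_multiplicity_mult_distrib[OF pe] del: mult_Suc_right)
    moreover have "multiplicity p (p * Suc n) = 1 + multiplicity p (Suc n)"
      using p0 p by (simp add: prime_elem_multiplicity_mult_distrib[OF pe] multiplicity_self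
          del: mult_Suc_right)
    moreover have "multiplicity p (fact (Suc n) :: nat) = multiplicity p (Suc n) + multiplicity p (fact n :: nat)"
      by (simp add: fact_Suc prime_elem_multiplicity_mult_distrib[OF pe] del: mult_Suc)
    ultimately show ?case by simp
  next
    case (Suc r)
    have "\<not> p dvd (p * Suc n + Suc r)" using Suc.prems
      by (meson dvd_add_right_iff dvd_triv_left nat_dvd_not_less zero_less_Suc)
    hence "multiplicity p (p * Suc n + Suc r) = 0" by (rule not_dvd_imp_multiplicity_0)
    moreover have "(fact (p * Suc n + Suc r) :: nat) = (p * Suc n + Suc r) * fact (p * Suc n + r)"
      by simp
    ultimately show ?case using Suc
      by (simp add: prime_elem_multiplicity_mult_distrib[OF pe] del: mult_Suc_right fact_Suc add_Suc_right)
  qed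
qed

text \<open>All base-\<open>p\<close> digits of \<open>f\<close> equal \<open>(p - 1) / 4\<close>, so adding \<open>f\<close> to itself produces no carry.\<close>
lemma not_dvd_central_binomial_quarter:
  fixes p f :: nat
  assumes p: "prime p" "p mod 4 = 1" and f: "4 * f + 1 = p ^ m"
  shows "\<not> p dvd (2 * f choose f)"
proof -
  obtain d where d: "p = 4 * d + 1" using p(2) by (metis div_mult_mod_eq mult.commute)
  have "multiplicity p (fact (2 * f)) = 2 * multiplicity p (fact f :: nat)"
    using f
  proof (induction m arbitrary: f)
    case 0
    thus ?case by simp
  next
    case (Suc m)
    have "[p ^ m = 1 ^ m] (mod 4)" using p(2) by (intro cong_pow) (simp add: cong_def)
    hence "p ^ m mod 4 = 1" by (simp add: cong_def)
    then obtain g where g: "4 * g + 1 = p ^ m" by (metis div_mult_mod_eq mult.commute)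
    have "4 * f + 1 = p * (4 * g + 1)" using Suc.prems g by simp
    \<comment> \<open>\<open>d\<close> is the last base-\<open>p\<close> digit of \<open>f\<close>
      and \<open>g\<close> is what remains. As \<open>2 * d < p\<close>, the last digit of
      \<open>2 * f\<close> is \<open>2 * d\<close>, so the multiplicity lemma applies to both
      factorials.\<close>
    hence f: "f = p * g + d" by (simp add: d algebra_simps)
    hence f2: "2 * f = p * (2 * g) + 2 * d" by simp
    show ?case unfolding f2 using multiplicity_fact_mult_add[OF p(1), of d g]
        multiplicity_fact_mult_add[OF p(1), of "2 * d" "2 * g"] Suc.IH[OF g] f d
      by simp
  qed
  moreover have "(fact (2 * f) :: nat) = (2 * f choose f) * (fact f * fact f)"
    using binomial_fact_lemma[of f "2 * f"] by (simp add: mult_ac)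
  ultimately have "multiplicity p (2 * f choose f) = 0"
    using p(1) by (simp add: prime_elem_multiplicity_mult_distrib)
  thus ?thesis using p(1) by (subst (asm) multiplicity_eq_zero_iff) auto
qed

text \<open>Here -1 is a square modulo \<open>p\<close>. If \<open>p\<close> were 3 modulo 4, then
  \<open>(p - 1) / 2\<close> would be odd, and raising \<open>v ^ 2 = -1\<close> to that power would
  contradict Fermat's little theorem.\<close>

lemma prime_dvd_one_plus_square_mod_4:
  fixes p v :: nat
  assumes p: "prime p" "odd p" and dvd: "p dvd 1 + v ^ 2"
  shows "p mod 4 = 1"
proof (rule ccontr)
  assume "p mod 4 \<noteq> 1"
  hence "p mod 4 = 3" using p(2) by presburger
  then obtain d where d: "p = 4 * d + 3" by (metis div_mult_mod_eq mult.commute)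
  have "\<not> p dvd v"
  proof
    assume "p dvd v"
    hence "p dvd v ^ 2" by (simp add: power2_eq_square)
    hence "p dvd 1" using dvd by (meson dvd_add_left_iff)
    thus False using p(1) by simp
  qed
  hence "[v ^ (p - 1) = 1] (mod p)" using fermat_theorem p(1) by blast
  hence v1: "[int v ^ (4 * d + 2) = 1] (mod int p)"
    using d by (metis (no_types, lifting) Suc_eq_plus1 add_diff_cancel_right' cong_int_iff numeral_2_eq_2 numeral_3_eq_3 of_nat_1 of_nat_power add_Suc_right)
  have "[int v ^ 2 = -1] (mod int p)"
    using dvd by (simp add: cong_iff_dvd_diff flip: int_dvd_int_iff) (simp add: add.commute)
  hence "[(int v ^ 2) ^ (2 * d + 1) = (-1) ^ (2 * d + 1)] (mod int p)" by (rule cong_pow)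
  moreover have "(int v ^ 2) ^ (2 * d + 1) = int v ^ (4 * d + 2)"
    unfolding power_mult[symmetric] by (rule arg_cong[where f = "power (int v)"]) simp
  ultimately have "[int v ^ (4 * d + 2) = -1] (mod int p)" by simp
  hence "[1 = -1] (mod int p)" using v1 by (metis cong_sym cong_trans)
  hence "int p dvd 2" by (simp add: cong_iff_dvd_diff)
  hence "p \<le> 2" by (auto dest: zdvd_imp_le)
  thus False using d by simp
qed

text \<open>In Gaussian integers: \<open>R + \<i>I\<close> and \<open>1 + \<i>v\<close> have norm \<open>p ^ m\<close> and are not divisible by \<open>p\<close>,
  so they agree up to a unit and conjugation.\<close>
lemma primitive_sum_two_squares_unique:
  fixes R I v :: int and p m :: nat
  assumes p: "prime p" "odd p" and q: "1 + v ^ 2 = int p ^ m" and RI: "R ^ 2 + I ^ 2 = int p ^ m"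
    and R: "\<not> int p dvd R" and "even I" and m: "m > 0"
  shows "R ^ 2 = 1"
proof -
  define q where "q = int p ^ m"
  have q0: "q > 0" using p(1) prime_gt_0_nat by (simp add: q_def)
  have qv: "1 + v ^ 2 = q" using q by (simp add: q_def)
  have pi: "prime (int p)" using p by simp
  have key: "R ^ 2 = 1" if even: "even I" and dv: "q dvd R * v + I" and nm: "R ^ 2 + I ^ 2 = q" for I :: int
  proof -
    obtain c where c: "R * v + I = q * c" using dv by blast
    \<comment> \<open>These are the real and imaginary parts of \<open>(R + i I) (1 + i v)\<close>,
      whose norm is \<open>q ^ 2\<close>. Hence \<open>c\<close> is 0, 1 or -1. The value 0 gives
      the claim, and the other two force \<open>I ^ 2 = 1\<close>, against evenness.\<close>
    have n: "(R - I * v) ^ 2 + (R * v + I) ^ 2 = q ^ 2"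
    proof -
      have "(R - I * v) ^ 2 + (R * v + I) ^ 2 = (R ^ 2 + I ^ 2) * (1 + v ^ 2)"
        by (simp add: power2_eq_square algebra_simps)
      thus ?thesis unfolding nm qv by (simp add: power2_eq_square)
    qed
    hence "q ^ 2 * c ^ 2 \<le> q ^ 2 * 1"
      using c zero_le_power2[of "R - I * v"] unfolding c power_mult_distrib by linarith
    hence c1: "c ^ 2 \<le> 1" using q0 by simp
    show ?thesis
    proof (cases "c = 0")
      case True
      hence "I = - (R * v)" using c by simp
      hence "R ^ 2 * (1 + v ^ 2) = q" using nm by (simp add: power_mult_distrib algebra_simps)
      hence "R ^ 2 * q = q" unfolding qv .
      thus ?thesis using q0 by simp
    next
      case False
      hence "c ^ 2 = 1" using c1 zero_less_power2[of c] by linarith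
      hence "(R - I * v) ^ 2 = 0" using n c by (simp add: power_mult_distrib)
      hence "R = I * v" by simp
      hence "I ^ 2 * (1 + v ^ 2) = q" using nm by (simp add: power_mult_distrib algebra_simps)
      hence "I ^ 2 * q = q" unfolding qv .
      hence "I ^ 2 = 1" using q0 by simp
      moreover have "even (I ^ 2)" using even by simp
      ultimately show ?thesis by simp
    qed
  qed
  have "(R * v + I) * (R * v - I) = q * (R ^ 2 - 1)"
  proof -
    have "(R * v + I) * (R * v - I) = R ^ 2 * v ^ 2 - I ^ 2"
      by (simp add: power2_eq_square algebra_simps)
    also have "v ^ 2 = q - 1" using qv by simp
    also have "I ^ 2 = q - R ^ 2" using RI q_def by simp
    finally show ?thesis by (simp add: algebra_simps)
  qed
  hence dv: "int p ^ m dvd (R * v + I) * (R * v - I)" by (simp add: q_def)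
  have nv: "\<not> int p dvd v"
  proof
    assume "int p dvd v"
    moreover have "int p dvd 1 + v ^ 2" using assms(3) m by simp
    moreover have "int p dvd v ^ 2" using \<open>int p dvd v\<close> by (simp add: power2_eq_square)
    ultimately have "int p dvd 1" by (meson dvd_add_left_iff)
    thus False using pi by simp
  qed
  \<comment> \<open>As \<open>p\<close> divides at most one of the factors, all of \<open>q\<close>
    divides the other. The two cases are exchanged by conjugation, that is by \<open>I\<close> going
    to \<open>- I\<close>.\<close>
  have "\<not> (int p dvd R * v + I \<and> int p dvd R * v - I)"
  proof
    assume "int p dvd R * v + I \<and> int p dvd R * v - I"
    hence "int p dvd (R * v + I) + (R * v - I)" by (meson dvd_add)
    hence "int p dvd 2 * (R * v)" by simp
    hence "int p dvd 2" using pi R nv by (metis prime_dvd_mult_iff)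
    hence "p dvd 2" using int_dvd_int_iff[of p 2] by simp
    thus False using p primes_dvd_imp_eq[OF p(1) two_is_prime_nat] by simp
  qed
  hence "coprime (int p ^ m) (R * v + I) \<or> coprime (int p ^ m) (R * v - I)"
    using pi by (metis coprime_power_left_iff prime_imp_coprime)
  hence "q dvd R * v + I \<or> q dvd R * v + (- I)"
    using dv by (auto simp: q_def coprime_dvd_mult_left_iff coprime_dvd_mult_right_iff)
  thus ?thesis using key[of I] key[of "- I"] \<open>even I\<close> RI by (auto simp: q_def)
qed

lemma root_of_unity_power_mod4: "(c::'b::comm_semiring_1) ^ 4 = 1 \<Longrightarrow> c ^ (k mod 4) = c ^ k"
proof -
  assume c: "c ^ 4 = 1"
  have "c ^ k = (c ^ 4) ^ (k div 4) * c ^ (k mod 4)"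
    by (simp only: power_mult[symmetric] power_add[symmetric] mult_div_mod_eq)
  thus ?thesis by (simp add: c)
qed

lemma sum_lessThan_4: "(\<Sum>i<4. g i) = g 0 + g 1 + g 2 + g (3::nat)" for g :: "nat \<Rightarrow> 'b::comm_monoid_add"
  by (simp add: eval_nat_numeral add.assoc)

section \<open>Discrete logarithms and quartic classes\<close>

text \<open>The number \<open>f\<close> is the \<open>l\<close> of the theorem. Its value
  \<open>4 * a ^ 2\<close> first enters in \<open>cyc_2_uniform\<close>; before that only evenness
  is used, that is \<open>q\<close> being 1 modulo 8.\<close>

locale quartic_cyclotomy =
  fixes \<gamma> :: "'a::{field,finite}" and f :: nat
  assumes primitive: "primitive_element \<gamma>"
    and card_field: "CARD('a) = 4 * f + 1"
    and even_f: "even f"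
begin

lemma gamma_nonzero [simp]: "\<gamma> \<noteq> 0"
  using primitive by (simp add: primitive_element_def)

lemma f_pos: "f > 0"
proof -
  have "card {0, 1 :: 'a} \<le> CARD('a)" by (rule card_mono) auto
  thus ?thesis using card_field by simp
qed

lemma card_nonzero: "card (UNIV - {0 :: 'a}) = 4 * f"
  using card_field by (simp add: card_Diff_subset)

lemma gamma_power_surj:
  assumes "d > 0" "\<gamma> ^ d = 1"
  shows "(\<lambda>k. \<gamma> ^ k) ` {..<d} = UNIV - {0}"
proof (intro equalityI subsetI)
  fix x assume "x \<in> UNIV - {0 :: 'a}"
  then obtain k where k: "x = \<gamma> ^ k" using primitive by (auto simp: primitive_element_def)
  have "\<gamma> ^ k = (\<gamma> ^ d) ^ (k div d) * \<gamma> ^ (k mod d)"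
    by (simp flip: power_mult power_add)
  thus "x \<in> (\<lambda>k. \<gamma> ^ k) ` {..<d}" using k assms by simp
qed auto

text \<open>Pigeonhole gives some positive \<open>d\<close> up to \<open>4 * f\<close> with
  \<open>\<gamma> ^ d = 1\<close>. Since \<open>d\<close> powers then exhaust the
  \<open>4 * f\<close> nonzero elements, \<open>d\<close> equals \<open>4 * f\<close>.\<close>

lemma gamma_power_order: "\<gamma> ^ (4 * f) = 1"
proof -
  have "\<not> inj_on (\<lambda>k. \<gamma> ^ k) {..4 * f}"
  proof
    assume "inj_on (\<lambda>k. \<gamma> ^ k) {..4 * f}"
    hence "card {..4 * f} \<le> card (UNIV - {0 :: 'a})"
      by (rule card_inj_on_le) auto
    thus False using card_nonzero by simp
  qed
  then obtain j k where jk: "j < k" "k \<le> 4 * f" "\<gamma> ^ j = \<gamma> ^ k"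
    unfolding inj_on_def by (metis atMost_iff linorder_neqE_nat)
  define d where "d = k - j"
  have "k = j + d" using jk by (simp add: d_def)
  hence "\<gamma> ^ k = \<gamma> ^ j * \<gamma> ^ d" by (simp add: power_add)
  hence d: "d > 0" "\<gamma> ^ d = 1" "d \<le> 4 * f" using jk by (auto simp: d_def)
  have "4 * f \<le> card {..<d}"
    unfolding card_nonzero[symmetric] gamma_power_surj[OF d(1,2), symmetric]
    by (rule card_image_le) simp
  thus ?thesis using d by simp
qed

lemma gamma_power_inj: "inj_on (\<lambda>k. \<gamma> ^ k) {..<4 * f}"
  using f_pos by (intro eq_card_imp_inj_on) (simp_all add: gamma_power_surj gamma_power_order card_nonzero)

lemma gamma_power_mod: "\<gamma> ^ (k mod (4 * f)) = \<gamma> ^ k"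
proof -
  have "\<gamma> ^ k = (\<gamma> ^ (4 * f)) ^ (k div (4 * f)) * \<gamma> ^ (k mod (4 * f))"
    by (simp only: power_mult[symmetric] power_add[symmetric] mult_div_mod_eq)
  thus ?thesis by (simp add: gamma_power_order)
qed

lemma gamma_power_eq_iff: "\<gamma> ^ j = \<gamma> ^ k \<longleftrightarrow> j mod (4 * f) = k mod (4 * f)"
proof
  assume "\<gamma> ^ j = \<gamma> ^ k"
  hence "\<gamma> ^ (j mod (4 * f)) = \<gamma> ^ (k mod (4 * f))" by (simp add: gamma_power_mod)
  thus "j mod (4 * f) = k mod (4 * f)"
    using inj_onD[OF gamma_power_inj] f_pos by simp
next
  assume "j mod (4 * f) = k mod (4 * f)"
  thus "\<gamma> ^ j = \<gamma> ^ k" by (metis gamma_power_mod)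
qed

lemma gamma_power_eq_1_iff: "\<gamma> ^ k = 1 \<longleftrightarrow> 4 * f dvd k"
  using gamma_power_eq_iff[of k 0] by (simp add: dvd_eq_mod_eq_0)

lemma nonzero_gamma_power: "x \<noteq> 0 \<Longrightarrow> \<exists>k. x = \<gamma> ^ k"
  using primitive by (auto simp: primitive_element_def)

lemma gamma_power_half: "\<gamma> ^ (2 * f) = -1"
proof -
  have "(\<gamma> ^ (2 * f)) ^ 2 = 1"
    using gamma_power_order by (simp flip: power_mult add: mult.commute)
  moreover have "\<gamma> ^ (2 * f) \<noteq> 1"
    using f_pos by (simp add: gamma_power_eq_1_iff dvd_imp_le nat_dvd_not_less)
  ultimately show ?thesis by (simp add: power2_eq_1_iff)
qed

text \<open>The value \<open>cls 0\<close> is junk.\<close>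
definition cls :: "'a \<Rightarrow> nat" where
  "cls x = (SOME k. x = \<gamma> ^ k) mod 4"

lemma cls_gamma_power [simp]: "cls (\<gamma> ^ k) = k mod 4"
proof -
  have "\<gamma> ^ k = \<gamma> ^ (SOME j. \<gamma> ^ k = \<gamma> ^ j)" by (rule someI[of _ k]) simp
  hence "k mod (4 * f) = (SOME j. \<gamma> ^ k = \<gamma> ^ j) mod (4 * f)" by (simp only: gamma_power_eq_iff)
  moreover have "i mod 4 = j mod 4" if "i mod (4 * f) = j mod (4 * f)" for i j
    using arg_cong[OF that, of "\<lambda>n. n mod 4"] by (simp add: mod_mod_cancel)
  ultimately have "k mod 4 = (SOME j. \<gamma> ^ k = \<gamma> ^ j) mod 4" by blast
  thus ?thesis by (simp add: cls_def)
qed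

lemma cls_less [simp]: "cls x < 4"
  by (simp add: cls_def)

lemma cls_cases: "cls x \<in> {0, 1, 2, 3}"
proof -
  have "n \<in> {0, 1, 2, 3}" if "n < 4" for n :: nat using that by auto
  thus ?thesis using cls_less by blast
qed

lemma cls_gamma [simp]: "cls \<gamma> = 1"
  using cls_gamma_power[of 1] by simp

lemma cls_1 [simp]: "cls 1 = 0"
  using cls_gamma_power[of 0] by simp

text \<open>As \<open>f\<close> is even, \<open>-1 = \<gamma> ^ (2 * f)\<close> is a fourth power,
  so the classes are closed under negation.\<close>

lemma cls_minus_1 [simp]: "cls (-1) = 0"
  using cls_gamma_power[of "2 * f"] even_f by (auto simp: gamma_power_half)

lemma cls_mult: "x \<noteq> 0 \<Longrightarrow> y \<noteq> 0 \<Longrightarrow> cls (x * y) = (cls x + cls y) mod 4"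
  using nonzero_gamma_power[of x] nonzero_gamma_power[of y]
  by (auto simp: mod_add_eq simp flip: power_add)

lemma cls_minus: "x \<noteq> 0 \<Longrightarrow> cls (- x) = cls x"
  using cls_mult[of "-1" x] by simp

lemma cls_inverse:
  assumes "x \<noteq> 0"
  shows "cls (inverse x) = (4 - cls x) mod 4"
proof -
  have "(cls x + cls (inverse x)) mod 4 = 0" using cls_mult[of x "inverse x"] assms by simp
  then obtain c where c: "cls x + cls (inverse x) = 4 * c" by auto
  note l = cls_less[of x] cls_less[of "inverse x"]
  show ?thesis
  proof (cases "cls x = 0")
    case True
    thus ?thesis using c l by simp
  next
    case False
    hence "c = 1" using c l by linarith
    hence "cls (inverse x) = 4 - cls x" using c by linarith
    moreover have "4 - cls x < 4" using False by simp
    ultimately show ?thesis by (simp only: mod_less)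
  qed
qed

lemma cls_divide: "x \<noteq> 0 \<Longrightarrow> y \<noteq> 0 \<Longrightarrow> cls (x / y) = (cls x + 4 - cls y) mod 4"
  using cls_mult[of x "inverse y"] cls_inverse[of y] cls_less[of y]
  by (simp add: divide_inverse mod_add_right_eq)

definition D :: "nat \<Rightarrow> 'a set" where
  "D i = {x. x \<noteq> 0 \<and> cls x = i}"

lemma cyclotomic_class_eq:
  assumes "i < 4"
  shows "cyclotomic_class \<gamma> 4 i = D i"
proof (intro equalityI subsetI)
  fix x assume "x \<in> cyclotomic_class \<gamma> 4 i"
  then obtain k where "x = \<gamma> ^ (i + 4 * k)"
    by (auto simp: cyclotomic_class_def power_add power_mult)
  thus "x \<in> D i" using assms by (simp add: D_def)
next
  fix x assume x: "x \<in> D i"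
  then obtain k where k: "x = \<gamma> ^ k" using nonzero_gamma_power by (auto simp: D_def)
  hence "k mod 4 = i" using x by (simp add: D_def)
  then obtain c where "k = i + 4 * c" by (metis add.commute div_mult_mod_eq mult.commute)
  hence "x = \<gamma> ^ i * (\<gamma> ^ 4) ^ c" unfolding k by (simp only: power_add power_mult)
  thus "x \<in> cyclotomic_class \<gamma> 4 i" unfolding cyclotomic_class_def mem_Collect_eq
    by (intro exI[of _ c] conjI TrueI)
qed

text \<open>The powers of \<open>\<gamma> ^ 4\<close> form a subgroup of order \<open>f\<close>, so
  dividing \<open>t\<close> by them runs once through its coset. In the digraph, \<open>k\<close>
  will be the second coordinate of the middle vertex of a path.\<close>

lemma bij_betw_D: "i < 4 \<Longrightarrow> t \<in> D i \<Longrightarrow> bij_betw (\<lambda>k. t / \<gamma> ^ (4 * k)) {0..<f} (D i)"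
proof (rule bij_betw_imageI)
  assume t: "t \<in> D i" "i < 4"
  show "inj_on (\<lambda>k. t / \<gamma> ^ (4 * k)) {0..<f}"
  proof (rule inj_onI)
    fix j k assume "j \<in> {0..<f}" "k \<in> {0..<f}" "t / \<gamma> ^ (4 * j) = t / \<gamma> ^ (4 * k)"
    moreover from this have "\<gamma> ^ (4 * j) = \<gamma> ^ (4 * k)"
      using t by (simp add: D_def field_simps)
    ultimately show "j = k" by (simp only: gamma_power_eq_iff) simp
  qed
  show "(\<lambda>k. t / \<gamma> ^ (4 * k)) ` {0..<f} = D i"
  proof (intro equalityI subsetI)
    fix x assume "x \<in> (\<lambda>k. t / \<gamma> ^ (4 * k)) ` {0..<f}"
    thus "x \<in> D i" using t by (auto simp: D_def cls_divide)
  next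
    fix x assume x: "x \<in> D i"
    have "t / x \<noteq> 0" using x t by (simp add: D_def)
    then obtain k where k: "t / x = \<gamma> ^ k" using nonzero_gamma_power by blast
    have "k mod 4 = cls (t / x)" by (simp add: k)
    also have "\<dots> = 0" using x t by (simp add: D_def cls_divide)
    finally obtain c where c: "k = 4 * c" by auto
    have "\<gamma> ^ (4 * (c mod f)) = \<gamma> ^ k" using c gamma_power_mod[of k] by simp
    hence "x = t / \<gamma> ^ (4 * (c mod f))" using k x t by (auto simp: D_def field_simps)
    thus "x \<in> (\<lambda>k. t / \<gamma> ^ (4 * k)) ` {0..<f}" using f_pos by auto
  qed
qed

lemma card_D: "i < 4 \<Longrightarrow> card (D i) = f"
  using bij_betw_same_card[OF bij_betw_D[of i "\<gamma> ^ i"]] by (simp add: D_def)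

lemma sum_nonzero_D:
  fixes g :: "'a \<Rightarrow> 'b::comm_monoid_add"
  assumes "g 0 = 0"
  shows "(\<Sum>x\<in>UNIV. g x) = (\<Sum>i<4. \<Sum>x\<in>D i. g x)"
proof -
  have "(\<Sum>x\<in>UNIV. g x) = (\<Sum>x\<in>UNIV - {0}. g x)"
    using assms by (intro sum.mono_neutral_right) auto
  also have "\<dots> = (\<Sum>i<4. \<Sum>x\<in>{x \<in> UNIV - {0}. cls x = i}. g x)"
    by (rule sum.group[symmetric]) auto
  also have "\<dots> = (\<Sum>i<4. \<Sum>x\<in>D i. g x)"
    by (intro sum.cong) (auto simp: D_def)
  finally show ?thesis .
qed

text \<open>Multiplication by \<open>\<gamma>\<close> permutes the field, so the sum equals
  \<open>c\<close> times itself. The codomain is general in order to cover integer and complex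
  characters as well as power sums in the field.\<close>

lemma sum_eq_0_if_gamma_eigen:
  fixes g :: "'a \<Rightarrow> 'b::idom"
  assumes "\<And>x. g (\<gamma> * x) = c * g x" "c \<noteq> 1"
  shows "(\<Sum>x\<in>UNIV. g x) = 0"
proof -
  have "bij (\<lambda>x. \<gamma> * x)"
    by (rule bij_betw_byWitness[where f' = "\<lambda>x. x / \<gamma>"]) auto
  hence "(\<Sum>x\<in>UNIV. g x) = (\<Sum>x\<in>UNIV. g (\<gamma> * x))"
    by (rule sum.reindex_bij_betw[symmetric])
  also have "\<dots> = c * (\<Sum>x\<in>UNIV. g x)" by (simp add: assms sum_distrib_left)
  finally show ?thesis using assms(2) by (metis mult_cancel_right1)
qed

section \<open>The quartic and quadratic characters\<close>

definition \<chi> :: "'a \<Rightarrow> complex" where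
  "\<chi> x = (if x = 0 then 0 else \<i> ^ cls x)"

text \<open>This is the square of \<open>\<chi>\<close>, the quadratic character. Integer values
  allow it to be mapped both into the complex numbers and into the field.\<close>

definition \<rho> :: "'a \<Rightarrow> int" where
  "\<rho> x = (if x = 0 then 0 else (-1) ^ cls x)"

lemma chi_mult: "\<chi> (x * y) = \<chi> x * \<chi> y"
  by (simp add: \<chi>_def cls_mult root_of_unity_power_mod4 power_add)

lemma rho_mult: "\<rho> (x * y) = \<rho> x * \<rho> y"
  by (simp add: \<rho>_def cls_mult root_of_unity_power_mod4 power_add)

lemma chi_0 [simp]: "\<chi> 0 = 0" and chi_1 [simp]: "\<chi> 1 = 1" and chi_gamma: "\<chi> \<gamma> = \<i>"
  and rho_0 [simp]: "\<rho> 0 = 0" and rho_1 [simp]: "\<rho> 1 = 1" and rho_gamma: "\<rho> \<gamma> = -1"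
  by (simp_all add: \<chi>_def \<rho>_def)

lemma rho_square: "x \<noteq> 0 \<Longrightarrow> \<rho> x * \<rho> x = 1"
  by (simp add: \<rho>_def flip: power_add)

lemma rho_divide: "y \<noteq> 0 \<Longrightarrow> \<rho> (x / y) = \<rho> x * \<rho> y"
  using rho_mult[of "x / y" y] rho_square[of y] by (simp add: mult.assoc)

lemma chi_cnj: "x \<noteq> 0 \<Longrightarrow> \<chi> x * cnj (\<chi> x) = 1"
  by (simp add: \<chi>_def flip: power_mult_distrib)

lemma sum_rho: "(\<Sum>x\<in>UNIV. \<rho> x) = 0"
  by (rule sum_eq_0_if_gamma_eigen[of _ "-1"]) (simp_all add: rho_mult rho_gamma)

lemma sum_chi: "(\<Sum>x\<in>UNIV. \<chi> x) = 0"
  by (rule sum_eq_0_if_gamma_eigen[of _ "\<i>"]) (simp_all add: chi_mult chi_gamma complex_eq_iff)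

lemma sum_chi_rho: "(\<Sum>x\<in>UNIV. \<chi> x * of_int (\<rho> x)) = 0"
  by (rule sum_eq_0_if_gamma_eigen[of _ "- \<i>"])
     (simp_all add: chi_mult chi_gamma rho_mult rho_gamma complex_eq_iff)

text \<open>The substitution \<open>w = (z y + 1) / (y + 1)\<close> turns the sum into \<open>\<Sum>w \<noteq> z. \<rho> w\<close>.\<close>
lemma sum_rho_quadratic:
  assumes "z \<noteq> 1"
  shows "(\<Sum>y\<in>UNIV. \<rho> (z * y + 1) * \<rho> (y + 1)) = - \<rho> z"
proof -
  have "(\<Sum>y\<in>UNIV. \<rho> (z * y + 1) * \<rho> (y + 1)) = (\<Sum>y\<in>UNIV - {-1}. \<rho> (z * y + 1) * \<rho> (y + 1))"
    by (intro sum.mono_neutral_right) auto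
  also have "\<dots> = (\<Sum>y\<in>UNIV - {-1}. \<rho> ((z * y + 1) / (y + 1)))"
    by (intro sum.cong) (auto simp: rho_divide eq_neg_iff_add_eq_0)
  also have "\<dots> = (\<Sum>w\<in>UNIV - {z}. \<rho> w)"
  proof (rule sum.reindex_bij_betw)
    \<comment> \<open>A Moebius map of determinant \<open>z - 1\<close>. It sends -1 to infinity and
      infinity to \<open>z\<close>, which explains the two omitted points.\<close>
    show "bij_betw (\<lambda>y. (z * y + 1) / (y + 1)) (UNIV - {-1}) (UNIV - {z})"
    proof (rule bij_betw_byWitness[where f' = "\<lambda>w. (1 - w) / (w - z)"])
      show "\<forall>y\<in>UNIV - {-1}. (1 - (z * y + 1) / (y + 1)) / ((z * y + 1) / (y + 1) - z) = y"
      proof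
        fix y assume "y \<in> UNIV - {-1 :: 'a}"
        hence y: "y + 1 \<noteq> 0" by (simp add: eq_neg_iff_add_eq_0)
        have "1 - (z * y + 1) / (y + 1) = y * (1 - z) / (y + 1)"
          using y by (simp add: field_simps)
        moreover have "(z * y + 1) / (y + 1) - z = (1 - z) / (y + 1)"
          using y by (simp add: field_simps)
        ultimately show "(1 - (z * y + 1) / (y + 1)) / ((z * y + 1) / (y + 1) - z) = y"
          using y assms by simp
      qed
      show "\<forall>w\<in>UNIV - {z}. (z * ((1 - w) / (w - z)) + 1) / ((1 - w) / (w - z) + 1) = w"
      proof
        fix w assume "w \<in> UNIV - {z}"
        hence w: "w - z \<noteq> 0" by simp
        have "z * ((1 - w) / (w - z)) + 1 = w * (1 - z) / (w - z)"
          using w by (simp add: field_simps)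
        moreover have "(1 - w) / (w - z) + 1 = (1 - z) / (w - z)"
          using w by (simp add: field_simps)
        ultimately show "(z * ((1 - w) / (w - z)) + 1) / ((1 - w) / (w - z) + 1) = w"
          using w assms by simp
      qed
      show "(\<lambda>y. (z * y + 1) / (y + 1)) ` (UNIV - {-1}) \<subseteq> UNIV - {z}"
        using assms by (auto simp: divide_eq_eq eq_neg_iff_add_eq_0 algebra_simps split: if_splits)
      show "(\<lambda>w. (1 - w) / (w - z)) ` (UNIV - {z}) \<subseteq> UNIV - {-1}"
        using assms by (auto simp: divide_eq_eq)
    qed
  qed
  also have "\<dots> = - \<rho> z" using sum_rho by (simp add: sum_diff1)
  finally show ?thesis .
qed

section \<open>The Jacobi sum, its norm and its residue\<close>

definition jacobi :: complex where
  "jacobi = (\<Sum>x\<in>UNIV. \<chi> x * of_int (\<rho> (x + 1)))"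

text \<open>Substituting \<open>x = z * y\<close> turns the double sum into the sum of
  \<open>\<chi> z\<close> times a quadratic correlation \<open>K z\<close>, which
  \<open>sum_rho_quadratic\<close> evaluates for \<open>z \<noteq> 1\<close>.\<close>

lemma jacobi_norm: "jacobi * cnj jacobi = of_nat CARD('a)"
proof -
  define K where "K z = (\<Sum>y\<in>UNIV - {0}. \<rho> (z * y + 1) * \<rho> (y + 1))" for z
  have K: "K z = (\<Sum>y\<in>UNIV. \<rho> (z * y + 1) * \<rho> (y + 1)) - 1" for z
    unfolding K_def by (subst sum_diff1) auto
  have K1: "K 1 = int CARD('a) - 2"
  proof -
    have "(\<Sum>y\<in>UNIV. \<rho> (y + 1) * \<rho> (y + 1)) = (\<Sum>y\<in>UNIV - {-1 :: 'a}. 1 :: int)"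
      by (intro sum.mono_neutral_cong_right) (auto simp: rho_square eq_neg_iff_add_eq_0)
    also have "\<dots> = int CARD('a) - 1" by (simp add: card_Diff_subset card_field)
    finally show ?thesis by (simp add: K)
  qed
  have "jacobi * cnj jacobi
      = (\<Sum>y\<in>UNIV. \<Sum>x\<in>UNIV. \<chi> x * of_int (\<rho> (x + 1)) * (cnj (\<chi> y) * of_int (\<rho> (y + 1))))"
    unfolding jacobi_def cnj_sum sum_product by (subst sum.swap) simp
  also have "\<dots> = (\<Sum>y\<in>UNIV - {0}. \<Sum>x\<in>UNIV. \<chi> x * of_int (\<rho> (x + 1)) * (cnj (\<chi> y) * of_int (\<rho> (y + 1))))"
    by (intro sum.mono_neutral_right) auto
  also have "\<dots> = (\<Sum>y\<in>UNIV - {0}. \<Sum>z\<in>UNIV. \<chi> z * of_int (\<rho> (z * y + 1) * \<rho> (y + 1)))"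
  proof (rule sum.cong[OF refl])
    fix y assume "y \<in> UNIV - {0 :: 'a}"
    hence y: "y \<noteq> 0" by simp
    have "bij (\<lambda>z. z * y)"
      using y by (intro bij_betw_byWitness[where f' = "\<lambda>z. z / y"]) auto
    hence "(\<Sum>x\<in>UNIV. \<chi> x * of_int (\<rho> (x + 1)) * (cnj (\<chi> y) * of_int (\<rho> (y + 1))))
        = (\<Sum>z\<in>UNIV. \<chi> (z * y) * of_int (\<rho> (z * y + 1)) * (cnj (\<chi> y) * of_int (\<rho> (y + 1))))"
      by (rule sum.reindex_bij_betw[symmetric])
    also have "\<dots> = (\<Sum>z\<in>UNIV. (\<chi> y * cnj (\<chi> y)) * (\<chi> z * of_int (\<rho> (z * y + 1) * \<rho> (y + 1))))"
      by (intro sum.cong) (simp_all add: chi_mult mult_ac)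
    finally show "(\<Sum>x\<in>UNIV. \<chi> x * of_int (\<rho> (x + 1)) * (cnj (\<chi> y) * of_int (\<rho> (y + 1))))
        = (\<Sum>z\<in>UNIV. \<chi> z * of_int (\<rho> (z * y + 1) * \<rho> (y + 1)))"
      using y by (simp add: chi_cnj)
  qed
  also have "\<dots> = (\<Sum>z\<in>UNIV. \<chi> z * of_int (K z))"
    by (subst sum.swap) (simp add: K_def sum_distrib_left)
  \<comment> \<open>At \<open>z = 1\<close> the generic value \<open>- \<rho> z - 1\<close> is -2,
    while \<open>K 1\<close> is \<open>q - 2\<close>. The indicator carries this difference; all
    other terms cancel by orthogonality.\<close>
  also have "\<dots> = (\<Sum>z\<in>UNIV. (- (\<chi> z * of_int (\<rho> z)) - \<chi> z) + (if z = 1 then of_nat CARD('a) else 0))"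
  proof (rule sum.cong[OF refl])
    fix z
    show "\<chi> z * of_int (K z) = (- (\<chi> z * of_int (\<rho> z)) - \<chi> z) + (if z = 1 then of_nat CARD('a) else 0)"
    proof (cases "z = 1")
      case True
      thus ?thesis by (simp add: K1)
    next
      case False
      hence Kz: "K z = - \<rho> z - 1" by (simp add: K sum_rho_quadratic)
      show ?thesis unfolding Kz using False by (simp add: algebra_simps)
    qed
  qed
  also have "\<dots> = of_nat CARD('a)"
    by (simp only: sum.distrib sum_subtractf sum_negf sum_chi sum_chi_rho) simp
  finally show ?thesis .
qed

definition T :: "nat \<Rightarrow> int" where
  "T i = (\<Sum>x\<in>D i. \<rho> (x + 1))"

lemma jacobi_eq: "jacobi = of_int (T 0 - T 2) + \<i> * of_int (T 1 - T 3)"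
proof -
  have "jacobi = (\<Sum>i<4. \<Sum>x\<in>D i. \<chi> x * of_int (\<rho> (x + 1)))"
    unfolding jacobi_def by (rule sum_nonzero_D) simp
  also have "\<dots> = (\<Sum>i<4. \<i> ^ i * of_int (T i))"
    unfolding T_def of_int_sum sum_distrib_left
    by (intro sum.cong refl) (auto simp: D_def \<chi>_def)
  also have "\<dots> = of_int (T 0 - T 2) + \<i> * of_int (T 1 - T 3)"
    by (simp add: sum_lessThan_4 power3_eq_cube algebra_simps)
  finally show ?thesis .
qed

lemma T_sum_two_squares: "(T 0 - T 2) ^ 2 + (T 1 - T 3) ^ 2 = int CARD('a)"
proof -
  have "complex_of_real (real_of_int ((T 0 - T 2) ^ 2 + (T 1 - T 3) ^ 2)) = jacobi * cnj jacobi"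
    unfolding jacobi_eq by (simp add: complex_eq_iff power2_eq_square algebra_simps)
  also have "\<dots> = complex_of_real (real_of_int (int CARD('a)))" by (simp add: jacobi_norm)
  finally show ?thesis by (simp only: of_real_eq_iff of_int_eq_iff)
qed

text \<open>The Jacobi sum is congruent to \<open>- binom(2f, f)\<close> modulo one of the primes of \<open>\<int>[\<i>]\<close> above
  the characteristic.\<close>
lemma jacobi_in_field:
  "of_int (T 0 - T 2) + \<gamma> ^ (3 * f) * of_int (T 1 - T 3) = - (of_nat (2 * f choose f) :: 'a)"
proof -
  \<comment> \<open>\<open>w\<close> plays the role of the imaginary unit:
    \<open>x ^ (3 * f)\<close> and \<open>x ^ (2 * f)\<close> are the reductions of
    \<open>\<chi>\<close> and \<open>\<rho>\<close>. Taking \<open>x ^ f\<close> instead, for the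
    conjugate prime, would only meet exponents from \<open>f\<close> to \<open>3 * f\<close> and
    give 0.\<close>
  define w where "w = \<gamma> ^ (3 * f)"
  have w2: "w ^ 2 = -1"
  proof -
    have "w ^ 2 = \<gamma> ^ (4 * f) * \<gamma> ^ (2 * f)" by (simp add: w_def flip: power_mult power_add)
    thus ?thesis by (simp add: gamma_power_order gamma_power_half)
  qed
  have w4: "w ^ 4 = 1" using w2 power_mult[of w 2 2] by simp
  have rho_F: "x ^ (2 * f) = of_int (\<rho> x)" for x :: 'a
  proof (cases "x = 0")
    case False
    then obtain k where k: "x = \<gamma> ^ k" using nonzero_gamma_power by blast
    have "x ^ (2 * f) = (\<gamma> ^ (2 * f)) ^ k" by (simp add: k mult.commute flip: power_mult)
    also have "\<dots> = (-1) ^ (k mod 4)" by (simp add: gamma_power_half root_of_unity_power_mod4)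
    finally show ?thesis by (simp add: \<rho>_def k)
  qed (use f_pos in simp)
  have chi_F: "x ^ (3 * f) = w ^ cls x" if "x \<noteq> 0" for x :: 'a
  proof -
    obtain k where k: "x = \<gamma> ^ k" using nonzero_gamma_power \<open>x \<noteq> 0\<close> by blast
    have "x ^ (3 * f) = w ^ k" by (simp add: k w_def mult.commute flip: power_mult)
    thus ?thesis using w4 by (simp add: k root_of_unity_power_mod4)
  qed
  \<comment> \<open>The exponents run from \<open>3 * f\<close> to \<open>5 * f\<close>, and
    \<open>4 * f\<close> is the only multiple of \<open>4 * f\<close> among them. There the sum
    counts the nonzero elements, which gives \<open>q - 1 = -1\<close>.\<close>
  have pow_sum: "(\<Sum>x\<in>UNIV. (x::'a) ^ (3 * f + k)) = (if k = f then -1 else 0)" if "k \<le> 2 * f" for k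
  proof (cases "k = f")
    case True
    have "(\<Sum>x\<in>UNIV. (x::'a) ^ (3 * f + k)) = (\<Sum>x\<in>UNIV - {0 :: 'a}. 1)"
    proof (rule sum.mono_neutral_cong_right)
      fix x assume "x \<in> UNIV - {0 :: 'a}"
      then obtain j where "x = \<gamma> ^ j" using nonzero_gamma_power by blast
      hence "x ^ (4 * f) = (\<gamma> ^ (4 * f)) ^ j" by (simp add: mult.commute flip: power_mult)
      thus "x ^ (3 * f + k) = 1" using True by (simp add: gamma_power_order)
    qed (use f_pos in auto)
    also have "\<dots> = of_nat (4 * f)" using card_nonzero by simp
    also have "\<dots> = of_nat CARD('a) - 1" by (simp add: card_field)
    also have "of_nat CARD('a) = (0 :: 'a)" using CHAR_dvd_CARD of_nat_eq_0_iff_char_dvd by blast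
    finally show ?thesis using True by simp
  next
    case False
    have "\<not> 4 * f dvd 3 * f + k"
    proof
      assume "4 * f dvd 3 * f + k"
      then obtain c where c: "3 * f + k = 4 * f * c" by blast
      consider "c = 0" | "c = 1" | "c \<ge> 2" by linarith
      thus False
      proof cases
        case 3
        hence "4 * f * 2 \<le> 4 * f * c" by (intro mult_left_mono) auto
        thus ?thesis using c that f_pos by linarith
      qed (use c False f_pos in auto)
    qed
    hence "(\<Sum>x\<in>UNIV. (x::'a) ^ (3 * f + k)) = 0"
      by (intro sum_eq_0_if_gamma_eigen[of _ "\<gamma> ^ (3 * f + k)"])
         (simp_all add: power_mult_distrib gamma_power_eq_1_iff)
    thus ?thesis using False by simp
  qed
  have "(\<Sum>x\<in>UNIV. x ^ (3 * f) * (x + 1) ^ (2 * f))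
      = (\<Sum>i<4. \<Sum>x\<in>D i. x ^ (3 * f) * (x + 1) ^ (2 * f))"
    using f_pos by (intro sum_nonzero_D) simp
  also have "\<dots> = (\<Sum>i<4. w ^ i * of_int (T i))"
    unfolding T_def of_int_sum sum_distrib_left
    by (intro sum.cong refl) (auto simp: D_def chi_F rho_F)
  also have "\<dots> = of_int (T 0 - T 2) + w * of_int (T 1 - T 3)"
    using w2 by (simp add: sum_lessThan_4 power3_eq_cube power2_eq_square algebra_simps)
  finally have "of_int (T 0 - T 2) + w * of_int (T 1 - T 3)
      = (\<Sum>x\<in>UNIV. x ^ (3 * f) * (x + 1) ^ (2 * f))" by simp
  also have "\<dots> = (\<Sum>x\<in>UNIV. \<Sum>k\<le>2 * f. of_nat (2 * f choose k) * x ^ (3 * f + k))"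
    by (simp add: binomial_ring sum_distrib_left power_add mult_ac)
  also have "\<dots> = (\<Sum>k\<le>2 * f. of_nat (2 * f choose k) * (\<Sum>x\<in>UNIV. x ^ (3 * f + k)))"
    by (subst sum.swap) (simp add: sum_distrib_left)
  also have "\<dots> = (\<Sum>k\<le>2 * f. if k = f then - of_nat (2 * f choose f) else 0)"
    by (intro sum.cong refl) (simp add: pow_sum)
  also have "\<dots> = - of_nat (2 * f choose f)" by simp
  finally show ?thesis by (simp add: w_def)
qed

section \<open>Cyclotomic numbers of order 4\<close>

definition cyc :: "nat \<Rightarrow> nat \<Rightarrow> nat" where
  "cyc i j = card {x \<in> D i. x + 1 \<in> D j}"

text \<open>The involution \<open>x\<close> to \<open>- 1 - x\<close> exchanges the two conditions,
  because negation preserves classes.\<close>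

lemma cyc_commute: "cyc i j = cyc j i"
  unfolding cyc_def
proof (rule bij_betw_same_card[of "\<lambda>x. - 1 - x"], rule bij_betw_byWitness[where f' = "\<lambda>x. - 1 - x"])
  have **: "- x \<in> D j \<longleftrightarrow> x \<in> D j" for x j
    using cls_minus[of x] by (auto simp: D_def)
  have *: "- 1 - x \<in> D j \<longleftrightarrow> x + 1 \<in> D j" for x j
  proof -
    have "- 1 - x = - (x + 1)" by simp
    thus ?thesis by (simp only: **)
  qed
  show "(\<lambda>x. - 1 - x) ` {x \<in> D i. x + 1 \<in> D j} \<subseteq> {x \<in> D j. x + 1 \<in> D i}"
    "(\<lambda>x. - 1 - x) ` {x \<in> D j. x + 1 \<in> D i} \<subseteq> {x \<in> D i. x + 1 \<in> D j}"
    by (auto simp: * **)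
qed auto

text \<open>Inversion is used: \<open>1 / x + 1 = (x + 1) / x\<close> shifts the second class by
  that of \<open>x\<close>.\<close>

lemma cyc_inverse:
  assumes "i < 4" "j < 4"
  shows "cyc i j = cyc ((4 - i) mod 4) ((j + 4 - i) mod 4)"
  unfolding cyc_def
proof (rule bij_betw_same_card[of inverse], rule bij_betw_byWitness[where f' = inverse])
  have *: "inverse x + 1 = (x + 1) / x" if "x \<noteq> 0" for x :: 'a
    using that by (simp add: field_simps)
  have **: "inverse ` {x \<in> D i. x + 1 \<in> D j} \<subseteq> {x \<in> D ((4 - i) mod 4). x + 1 \<in> D ((j + 4 - i) mod 4)}"
    for i j
    by (auto simp: D_def cls_inverse * cls_divide)
  show "inverse ` {x \<in> D i. x + 1 \<in> D j} \<subseteq> {x \<in> D ((4 - i) mod 4). x + 1 \<in> D ((j + 4 - i) mod 4)}"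
    by (rule **)
  \<comment> \<open>The transformation of indices is an involution, so the inclusion just proved
    also yields its converse.\<close>
  have "i = 0 \<or> i = 1 \<or> i = 2 \<or> i = 3" "j = 0 \<or> j = 1 \<or> j = 2 \<or> j = 3" using assms by auto
  hence e: "(4 - (4 - i) mod 4) mod 4 = i" "((j + 4 - i) mod 4 + 4 - (4 - i) mod 4) mod 4 = j"
    by (elim disjE; simp)+
  show "inverse ` {x \<in> D ((4 - i) mod 4). x + 1 \<in> D ((j + 4 - i) mod 4)} \<subseteq> {x \<in> D i. x + 1 \<in> D j}"
    using **[of "(4 - i) mod 4" "(j + 4 - i) mod 4"] unfolding e .
qed auto

lemma T_eq_cyc: "T i = int (cyc i 0) - int (cyc i 1) + int (cyc i 2) - int (cyc i 3)"
proof -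
  have "T i = (\<Sum>x\<in>D i. \<Sum>j<4. (-1) ^ j * of_bool (x + 1 \<in> D j))"
    unfolding T_def
  proof (rule sum.cong[OF refl])
    fix x
    have "cls (x + 1) \<in> {0, 1, 2, 3}" by (rule cls_cases)
    thus "\<rho> (x + 1) = (\<Sum>j<4. (-1) ^ j * of_bool (x + 1 \<in> D j))"
      by (auto simp: \<rho>_def D_def sum_lessThan_4)
  qed
  also have "\<dots> = (\<Sum>j<4. (-1) ^ j * (\<Sum>x\<in>D i. of_bool (x + 1 \<in> D j)))"
    by (subst sum.swap) (simp only: sum_distrib_left)
  also have "\<dots> = (\<Sum>j<4. (-1) ^ j * int (cyc i j))"
    by (intro sum.cong refl) (simp add: cyc_def sum.If_cases of_bool_def Int_def)
  finally show ?thesis by (simp add: sum_lessThan_4)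
qed

text \<open>Only \<open>x = -1\<close> has \<open>x + 1\<close> outside all classes, and it lies in
  \<open>D 0\<close>.\<close>

lemma cyc_row_sum:
  assumes "i < 4"
  shows "cyc i 0 + cyc i 1 + cyc i 2 + cyc i 3 = (if i = 0 then f - 1 else f)"
proof -
  have "card (D i - {-1}) = (\<Sum>j<4. cyc i j)"
  proof -
    have "(\<Sum>x\<in>D i - {-1}. 1 :: nat) = (\<Sum>j<4. \<Sum>x\<in>{x \<in> D i - {-1}. cls (x + 1) = j}. 1)"
      by (rule sum.group[symmetric]) auto
    also have "\<dots> = (\<Sum>j<4. cyc i j)"
      unfolding cyc_def by (intro sum.cong refl) (auto intro!: arg_cong[of _ _ card] simp: D_def eq_neg_iff_add_eq_0)
    finally show ?thesis by simp
  qed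
  moreover have "-1 \<in> D i \<longleftrightarrow> i = 0" by (auto simp: D_def)
  ultimately show ?thesis using assms by (auto simp: sum_lessThan_4 card_D card_Diff_singleton_if)
qed

text \<open>The two symmetries leave at most five distinct values among the sixteen numbers, and the
  row sums relate these. The summand -1 comes from the shorter row 0; it later fixes the
  sign.\<close>

lemma T_in_terms_of_cyc:
  shows "T 0 - T 2 = 4 * int (cyc 1 2) - 4 * int (cyc 0 2) - 1"
    and "even (T 1 - T 3)"
    and "cyc 2 2 = cyc 0 2" "cyc 3 2 = cyc 1 2" "2 * (cyc 0 2 + cyc 1 2) = f"
proof -
  have c: "cyc 2 0 = cyc 0 2" "cyc 1 0 = cyc 0 1" "cyc 3 0 = cyc 0 3" "cyc 2 1 = cyc 1 2"
     "cyc 3 1 = cyc 1 3" "cyc 3 2 = cyc 2 3"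
    by (simp_all only: cyc_commute)
  have i: "cyc 2 2 = cyc 2 0" "cyc 1 2 = cyc 3 1" "cyc 1 3 = cyc 3 2" "cyc 1 1 = cyc 3 0"
     "cyc 3 3 = cyc 1 0"
    using cyc_inverse[of 2 2] cyc_inverse[of 1 2] cyc_inverse[of 1 3] cyc_inverse[of 1 1]
      cyc_inverse[of 3 3] by simp_all
  note r = cyc_row_sum[of 0] cyc_row_sum[of 1] cyc_row_sum[of 2]
  show "cyc 2 2 = cyc 0 2" "cyc 3 2 = cyc 1 2" using c i by simp_all
  show "2 * (cyc 0 2 + cyc 1 2) = f" using c i r by simp
  show "T 0 - T 2 = 4 * int (cyc 1 2) - 4 * int (cyc 0 2) - 1"
    unfolding T_eq_cyc using c i r f_pos by simp
  show "even (T 1 - T 3)" unfolding T_eq_cyc using c i by simp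
qed

lemma cyc_2_uniform:
  assumes "a > 0" and f: "f = 4 * a ^ 2" and "i < 4"
  shows "cyc i 2 = a ^ 2"
proof -
  define p where "p = CHAR('a)"
  obtain m where m: "CARD('a) = p ^ m" using CARD_field_prime_power p_def by metis
  have p: "prime p" unfolding p_def by (intro prime_CHAR_semidom finite_imp_CHAR_pos) simp
  have q: "4 * f + 1 = p ^ m" using m card_field by simp
  have m0: "m > 0" using q f_pos by (cases m) auto
  hence pq: "p dvd 4 * f + 1" using q by simp
  have oddp: "odd p"
  proof
    assume "even p"
    hence "even (4 * f + 1)" using pq by (meson dvd_trans)
    thus False by simp
  qed
  have "p dvd 1 + (4 * a) ^ 2" using pq by (simp add: f power_mult_distrib)
  hence p4: "p mod 4 = 1" by (rule prime_dvd_one_plus_square_mod_4[OF p oddp])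
  have RI: "(T 0 - T 2) ^ 2 + (T 1 - T 3) ^ 2 = int p ^ m"
    using T_sum_two_squares m by simp
  \<comment> \<open>If \<open>p\<close> divided the real part, the norm would make it divide the
    imaginary part too. The reduction of the Jacobi sum would then vanish, contradicting that the
    central binomial is prime to \<open>p\<close>.\<close>
  have "\<not> int p dvd T 0 - T 2"
  proof
    assume R: "int p dvd T 0 - T 2"
    have "int p dvd int p ^ m" using m0 by simp
    moreover have "int p dvd (T 0 - T 2) ^ 2" using R by (simp add: power2_eq_square)
    ultimately have "int p dvd (T 1 - T 3) ^ 2" using RI by (metis dvd_add_right_iff)
    hence I: "int p dvd T 1 - T 3" using p by (simp add: prime_dvd_power_iff)
    have z: "of_int c = (0 :: 'a)" if "int p dvd c" for c
      using that by (simp add: of_int_eq_0_iff_char_dvd p_def)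
    have "of_nat (2 * f choose f) = (0 :: 'a)"
      using jacobi_in_field unfolding z[OF R] z[OF I] by simp
    hence "p dvd (2 * f choose f)" by (simp add: of_nat_eq_0_iff_char_dvd p_def)
    thus False using not_dvd_central_binomial_quarter[OF p p4 q] by blast
  qed
  moreover have "1 + (4 * int a) ^ 2 = int p ^ m"
    using q unfolding f by (simp add: power_mult_distrib flip: of_nat_power)
  ultimately have "(T 0 - T 2) ^ 2 = 1"
    using primitive_sum_two_squares_unique[OF p oddp _ RI] T_in_terms_of_cyc(2) m0 by blast
  hence "T 0 - T 2 = 1 \<or> T 0 - T 2 = -1" by (simp add: power2_eq_1_iff)
  \<comment> \<open>The value 1 is excluded because 2 is not a multiple of 4.\<close>
  hence "cyc 1 2 = cyc 0 2" unfolding T_in_terms_of_cyc(1) by presburger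
  moreover have "i \<in> {0, 1, 2, 3}" using \<open>i < 4\<close> by auto
  ultimately show ?thesis using T_in_terms_of_cyc(3-5) f by auto
qed

text \<open>For nonzero \<open>t\<close> the quotients run through the class of \<open>t\<close>, so
  the count is a cyclotomic number \<open>cyc i 2\<close>, and these all agree. For
  \<open>t = 0\<close> it is 0, since 1 is not in \<open>D 2\<close>.\<close>

lemma count_translates:
  assumes "a > 0" and f: "f = 4 * a ^ 2"
  shows "card {k \<in> {0..<f}. t / \<gamma> ^ (4 * k) + 1 \<in> D 2} = (if t = 0 then 0 else a ^ 2)"
proof (cases "t = 0")
  case True
  thus ?thesis by (simp add: D_def)
next
  case False
  hence bij: "bij_betw (\<lambda>k. t / \<gamma> ^ (4 * k)) {0..<f} (D (cls t))"
    by (intro bij_betw_D) (simp_all add: D_def)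
  have "bij_betw (\<lambda>k. t / \<gamma> ^ (4 * k)) {k \<in> {0..<f}. t / \<gamma> ^ (4 * k) + 1 \<in> D 2}
      {x \<in> D (cls t). x + 1 \<in> D 2}"
    by (rule bij_betw_Collect[OF bij]) simp
  hence "card {k \<in> {0..<f}. t / \<gamma> ^ (4 * k) + 1 \<in> D 2} = cyc (cls t) 2"
    unfolding cyc_def by (rule bij_betw_same_card)
  thus ?thesis using False cyc_2_uniform[OF assms] by simp
qed

section \<open>The semidirect product and its arcs\<close>

lemma gamma_power_4_mod: "\<gamma> ^ (4 * (k mod f)) = \<gamma> ^ (4 * k)"
  unfolding mult_mod_right by (rule gamma_power_mod)

lemma group_semidirect: "group (semidirect_grp \<gamma> f)"
proof (rule groupI)
  fix x y assume "x \<in> carrier (semidirect_grp \<gamma> f)" "y \<in> carrier (semidirect_grp \<gamma> f)"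
  thus "x \<otimes>\<^bsub>semidirect_grp \<gamma> f\<^esub> y \<in> carrier (semidirect_grp \<gamma> f)"
    using f_pos by (auto simp: semidirect_grp_def)
next
  fix x y z assume "x \<in> carrier (semidirect_grp \<gamma> f)" "y \<in> carrier (semidirect_grp \<gamma> f)"
    "z \<in> carrier (semidirect_grp \<gamma> f)"
  show "x \<otimes>\<^bsub>semidirect_grp \<gamma> f\<^esub> y \<otimes>\<^bsub>semidirect_grp \<gamma> f\<^esub> z
      = x \<otimes>\<^bsub>semidirect_grp \<gamma> f\<^esub> (y \<otimes>\<^bsub>semidirect_grp \<gamma> f\<^esub> z)"
    by (cases x; cases y; cases z)
       (simp add: semidirect_grp_def gamma_power_4_mod mod_add_left_eq mod_add_right_eq
          add.assoc distrib_left power_add mult.assoc)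
next
  fix x assume "x \<in> carrier (semidirect_grp \<gamma> f)"
  then obtain u i where x: "x = (u, i)" "i < f" by (auto simp: semidirect_grp_def)
  show "\<exists>y\<in>carrier (semidirect_grp \<gamma> f). y \<otimes>\<^bsub>semidirect_grp \<gamma> f\<^esub> x = \<one>\<^bsub>semidirect_grp \<gamma> f\<^esub>"
  proof (rule bexI)
    show "(- (\<gamma> ^ (4 * ((f - i) mod f)) * u), (f - i) mod f) \<otimes>\<^bsub>semidirect_grp \<gamma> f\<^esub> x
        = \<one>\<^bsub>semidirect_grp \<gamma> f\<^esub>"
      using x by (simp add: semidirect_grp_def mod_add_left_eq)
    show "(- (\<gamma> ^ (4 * ((f - i) mod f)) * u), (f - i) mod f) \<in> carrier (semidirect_grp \<gamma> f)"
      using f_pos by (simp add: semidirect_grp_def)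
  qed
qed (use f_pos in \<open>auto simp: semidirect_grp_def\<close>)

text \<open>Solving \<open>(x, i) (u, k) = (y, j)\<close> for \<open>u\<close> replaces the
  computation of an inverse. The second coordinate of the connection set is full, so only
  \<open>u\<close> is tested.\<close>

lemma cayley_arc_semidirect:
  assumes "i < f" "j < f"
  shows "cayley_arc (semidirect_grp \<gamma> f) (S \<times> {0..<f}) (x, i) (y, j) \<longleftrightarrow> (y - x) / \<gamma> ^ (4 * i) \<in> S"
proof -
  let ?G = "semidirect_grp \<gamma> f"
  interpret group ?G by (rule group_semidirect)
  have c: "(x, i) \<in> carrier ?G" "(y, j) \<in> carrier ?G"
    using assms by (simp_all add: semidirect_grp_def)
  obtain u k where uk: "inv\<^bsub>?G\<^esub> (x, i) \<otimes>\<^bsub>?G\<^esub> (y, j) = (u, k)" by fastforce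
  have "(u, k) \<in> carrier ?G" using c unfolding uk[symmetric] by simp
  hence k: "k < f" by (simp add: semidirect_grp_def)
  have "(x, i) \<otimes>\<^bsub>?G\<^esub> (u, k) = (y, j)" unfolding uk[symmetric] using c by (simp add: m_assoc[symmetric])
  hence "x + \<gamma> ^ (4 * i) * u = y" by (simp add: semidirect_grp_def)
  hence "u = (y - x) / \<gamma> ^ (4 * i)" by (auto simp: field_simps)
  thus ?thesis using k by (simp add: cayley_arc_def uk)
qed

end

section \<open>Degrees and paths of length two\<close>

theorem mainTheorem5:
  fixes \<gamma> :: "'a::{field,finite}" and a :: nat
  assumes "a > 0"
    and "CARD('a) = 1 + 16 * a ^ 2"
    and "primitive_element \<gamma>"
  defines "q \<equiv> CARD('a)"
  defines "l \<equiv> (q - 1) div 4"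
  defines "G \<equiv> semidirect_grp \<gamma> l"
  defines "S \<equiv> {-1 + x | x. x \<in> cyclotomic_class \<gamma> 4 2}"
  defines "E \<equiv> S \<times> {0..<l}"
  shows "dsrg (carrier G) (cayley_arc G E)
           (q * (q - 1) div 4) (((q - 1) div 4) ^ 2) (((q - 1) div 8) ^ 2)
           (((q - 1) div 8) ^ 2 - (q - 1) div 16) (((q - 1) div 8) ^ 2)"
proof -
  have q: "q = 1 + 16 * a ^ 2" and l: "l = 4 * a ^ 2"
    using assms(2) by (simp_all add: q_def l_def)
  interpret quartic_cyclotomy \<gamma> l
    using assms(2,3) l by unfold_locales auto
  have S: "x \<in> S \<longleftrightarrow> x + 1 \<in> D 2" for x
    unfolding S_def cyclotomic_class_eq[of 2, simplified]
    by (auto intro: exI[of _ "x + 1"])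
  have "S = (\<lambda>x. -1 + x) ` D 2" unfolding S_def cyclotomic_class_eq[of 2, simplified] by auto
  hence card_S: "card S = l" by (simp add: card_image card_D)
  have V: "carrier G = UNIV \<times> {0..<l}" by (simp add: G_def semidirect_grp_def)
  have arc: "cayley_arc G E (x, i) (y, j) \<longleftrightarrow> (y - x) / \<gamma> ^ (4 * i) \<in> S"
    if "i < l" "j < l" for x y i j
    unfolding G_def E_def by (rule cayley_arc_semidirect[OF that])
  have S0: "0 \<notin> S" by (simp add: S D_def)
  have card_out: "card {y. (y - x) / \<gamma> ^ (4 * i) \<in> S} = l" for x i
  proof -
    have "bij_betw (\<lambda>s. x + s * \<gamma> ^ (4 * i)) S {y. (y - x) / \<gamma> ^ (4 * i) \<in> S}"
      by (rule bij_betw_byWitness[where f' = "\<lambda>y. (y - x) / \<gamma> ^ (4 * i)"]) auto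
    thus ?thesis using bij_betw_same_card card_S by metis
  qed
  have card_in: "card {x. (y - x) / \<gamma> ^ (4 * i) \<in> S} = l" for y i
  proof -
    have "bij_betw (\<lambda>s. y - s * \<gamma> ^ (4 * i)) S {x. (y - x) / \<gamma> ^ (4 * i) \<in> S}"
      by (rule bij_betw_byWitness[where f' = "\<lambda>x. (y - x) / \<gamma> ^ (4 * i)"]) auto
    thus ?thesis using bij_betw_same_card card_S by metis
  qed
  have out: "card {w \<in> carrier G. cayley_arc G E v w} = l ^ 2" if vG: "v \<in> carrier G" for v
  proof -
    obtain x i where v: "v = (x, i)" "i < l" using vG by (auto simp: V)
    have "{w \<in> carrier G. cayley_arc G E v w} = {y. (y - x) / \<gamma> ^ (4 * i) \<in> S} \<times> {0..<l}"
      using v by (auto simp: V arc)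
    thus ?thesis by (simp add: card_cartesian_product card_out power2_eq_square)
  qed
  have inn: "card {v \<in> carrier G. cayley_arc G E v w} = l ^ 2" if wG: "w \<in> carrier G" for w
  proof -
    obtain y j where w: "w = (y, j)" "j < l" using wG by (auto simp: V)
    \<comment> \<open>The condition on the tail \<open>(x, i)\<close> depends on \<open>i\<close>,
      so the count fixes \<open>i\<close> first, and \<open>prod.swap\<close> restores the order of
      the coordinates.\<close>
    have "{v \<in> carrier G. cayley_arc G E v w}
        = prod.swap ` (SIGMA i:{0..<l}. {x. (y - x) / \<gamma> ^ (4 * i) \<in> S})"
      using w by (force simp: V arc image_iff)
    thus ?thesis by (simp add: card_image card_in power2_eq_square)
  qed
  have two: "card {z \<in> carrier G. cayley_arc G E v z \<and> cayley_arc G E z w}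
      = (if cayley_arc G E v w then l - 1 else l) * a ^ 2"
    if vw: "v \<in> carrier G" "w \<in> carrier G" for v w
  proof -
    obtain x i where v: "v = (x, i)" "i < l" using vw by (auto simp: V)
    obtain y j where w: "w = (y, j)" "j < l" using vw by (auto simp: V)
    \<comment> \<open>First coordinates \<open>u\<close> of the possible middle vertices
      \<open>(u, k)\<close>. The first arc leaves \<open>k\<close> free, and the second one is
      counted over \<open>k\<close> by \<open>count_translates\<close>.\<close>
    define W where "W = {u. (u - x) / \<gamma> ^ (4 * i) \<in> S}"
    have "{z \<in> carrier G. cayley_arc G E v z \<and> cayley_arc G E z w}
        = (SIGMA u:W. {k \<in> {0..<l}. (y - u) / \<gamma> ^ (4 * k) + 1 \<in> D 2})"
      using v w by (auto simp: V arc W_def S)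
    hence "card {z \<in> carrier G. cayley_arc G E v z \<and> cayley_arc G E z w}
        = (\<Sum>u\<in>W. card {k \<in> {0..<l}. (y - u) / \<gamma> ^ (4 * k) + 1 \<in> D 2})"
      by simp
    also have "\<dots> = (\<Sum>u\<in>W. if u = y then 0 else a ^ 2)"
      unfolding count_translates[OF assms(1) l] by (intro sum.cong refl) auto
    also have "\<dots> = (\<Sum>u\<in>W - {y}. a ^ 2)"
      by (intro sum.mono_neutral_cong_right) auto
    also have "\<dots> = card (W - {y}) * a ^ 2" by simp
    \<comment> \<open>The fibre over \<open>u = y\<close> is empty, and \<open>y\<close> belongs to
      \<open>W\<close> exactly when \<open>v\<close> has an arc to \<open>w\<close>. This lost fibre
      is the difference between \<open>lambda\<close> and \<open>mu\<close>.\<close>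
    also have "card (W - {y}) = (if y \<in> W then l - 1 else l)"
      using card_out by (simp add: card_Diff_singleton_if W_def)
    also have "y \<in> W \<longleftrightarrow> cayley_arc G E v w" using v w by (simp add: arc W_def)
    finally show ?thesis .
  qed
  have irrefl: "\<not> cayley_arc G E v v" if "v \<in> carrier G" for v
    using that S0 by (auto simp: V arc)
  \<comment> \<open>With these values \<open>t\<close> and \<open>mu\<close> are both
    \<open>l * a ^ 2\<close>, and \<open>lambda\<close> is \<open>(l - 1) * a ^ 2\<close>. The
    diagonal counts as non-adjacent because there are no loops.\<close>
  have p: "(q - 1) div 4 = l" "((q - 1) div 8) ^ 2 = l * a ^ 2" "(q - 1) div 16 = a ^ 2"
    "q * (q - 1) div 4 = q * l"
    by (simp_all add: q l power2_eq_square)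
  have "card (carrier G) = q * l" by (simp add: V card_cartesian_product q_def)
  thus ?thesis unfolding dsrg_def p
    using irrefl out inn two by (auto simp: V diff_mult_distrib)
qed

end
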